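(* Let $D=(V,A)$ be a digraph with $n=|V|$ vertices. For each permutation $\sigma\in\mathfrak{S}_V$ set \[\varphi(\sigma):=\sum_{\substack{\gamma\text{ a cycle of }\sigma;\\ \gamma\text{ is a }D\text{-cycle}}}\bigl(\ell(\gamma)-1\bigr).\] Then \[U_D=\sum_{\sigma\in\mathfrak{S}_V(D,\overline{D})}(-1)^{\varphi(\sigma)}\,p_{\operatorname{type}\sigma}.\]
   Context: A digraph is a pair $D=(V,A)$ with $V$ a finite set and $A\subseteq V\times V$ (loops allowed). Its complement is $\overline{D}=(V,(V\times V)\setminus A)$. A $V$-listing is a tuple $w=(w_1,\dots,w_n)$ containing each element of $V$ exactly once. For a $V$-listing $w$, $\operatorname{Des}(w,D)=\{i\in[n-1]:(w_i,w_{i+1})\in A\}$. For $I\subseteq[n-1]$, $L_{I,n}=\sum x_{i_1}x_{i_2}\cdots x_{i_n}$, the sum over all positive integers $i_1\le i_2\le\cdots\le i_n$ with $i_p<i_{p+1}$ for each $p\in I$. The Redei--Berge symmetric function is $U_D=\sum_{w}L_{\operatorname{Des}(w,D),n}$, summed over all $V$-listings $w$. Two nonempty tuples are rotation-equivalent if one is a cyclic rotation of the other. For $\sigma\in\mathfrak{S}_V$ (permutations of $V$), the cycles of $\sigma$ are the rotation-equivalence classes of the tuples $(i,\sigma(i),\dots,\sigma^{k-1}(i))$ with $i\in V$ and $k$ the least positive integer with $\sigma^k(i)=i$; the length $\ell(\gamma)$ of a class is the common length of its tuples; the cyclic arc set of the class of $(v_1,\dots,v_k)$ is $\operatorname{CArcs}\gamma=\{(v_1,v_2),\dots,(v_{k-1},v_k),(v_k,v_1)\}$.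 A $D$-cycle is a rotation-equivalence class $\gamma$ of nonempty tuples of distinct elements of $V$ with $\operatorname{CArcs}\gamma\subseteq A$ (similarly for $\overline{D}$-cycles). $\mathfrak{S}_V(D,\overline{D})$ is the set of $\sigma\in\mathfrak{S}_V$ each of whose cycles is a $D$-cycle or a $\overline{D}$-cycle. $\operatorname{type}\sigma$ is the partition whose entries are the lengths of the cycles of $\sigma$. $p_k=x_1^k+x_2^k+\cdots$ and $p_\lambda=p_{\lambda_1}p_{\lambda_2}\cdots p_{\lambda_m}$ for a partition $\lambda=(\lambda_1,\dots,\lambda_m)$. *)

theory Defs
  imports
    "HOL-Library.Multiset"
    "HOL-Combinatorics.Multiset_Permutations"
    "HOL-Combinatorics.Permutations"
    "HOL-Combinatorics.Cycles"
    "Graph_Theory.Pair_Digraph"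
begin

section \<open>Formal power series in the variables \<open>x\<^sub>i\<close>, \<open>i :: nat\<close>\<close>

text \<open>
  A monomial is encoded as the finite multiset of the indices of its variables, a power series
  as its coefficient function. The index \<open>0\<close> exists in the type but is never used below: all
  sums over indices run over the positive integers.
\<close>

typedef 'a mvps = "UNIV :: (nat multiset \<Rightarrow> 'a) set"
  morphisms mcoeff Abs_mvps ..

setup_lifting type_definition_mvps

lemma mvps_eqI: "(\<And>M. mcoeff f M = mcoeff g M) \<Longrightarrow> f = g"
  by (simp add: mcoeff_inject[symmetric] fun_eq_iff)

lemma finite_multiset_splits: "finite {(K, L). K + L = (M :: 'b multiset)}"
proof -
  have fin: "finite {xs. set xs \<subseteq> set_mset M \<and> length xs \<le> size M}"
    by (rule finite_lists_length_le) simp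
  have sub: "K \<in> mset ` {xs. set xs \<subseteq> set_mset M \<and> length xs \<le> size M}" if "K \<subseteq># M" for K
  proof -
    obtain xs where "mset xs = K" using ex_mset by blast
    then show ?thesis
      using set_mset_mono[OF that] size_mset_mono[OF that] by (auto intro!: image_eqI[of _ _ xs])
  qed
  have "{(K, L). K + L = M} \<subseteq>
    mset ` {xs. set xs \<subseteq> set_mset M \<and> length xs \<le> size M} \<times>
    mset ` {xs. set xs \<subseteq> set_mset M \<and> length xs \<le> size M}"
    using sub by (auto simp del: mem_Collect_eq simp: mset_subset_eq_add_left mset_subset_eq_add_right)
  then show ?thesis
    using fin by (meson finite_SigmaI finite_imageI finite_subset)
qed

instantiation mvps :: (comm_ring_1) comm_ring_1
begin

lift_definition zero_mvps :: "'a mvps" is "\<lambda>_. 0" .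
lift_definition one_mvps :: "'a mvps" is "\<lambda>M. if M = {#} then 1 else 0" .
lift_definition plus_mvps :: "'a mvps \<Rightarrow> 'a mvps \<Rightarrow> 'a mvps" is "\<lambda>f g M. f M + g M" .
lift_definition minus_mvps :: "'a mvps \<Rightarrow> 'a mvps \<Rightarrow> 'a mvps" is "\<lambda>f g M. f M - g M" .
lift_definition uminus_mvps :: "'a mvps \<Rightarrow> 'a mvps" is "\<lambda>f M. - f M" .
lift_definition times_mvps :: "'a mvps \<Rightarrow> 'a mvps \<Rightarrow> 'a mvps" is
  "\<lambda>f g M. \<Sum>(K, L)\<in>{(K, L). K + L = M}. f K * g L" .

instance
proof
  fix a b c :: "'a mvps"
  show "a * b * c = a * (b * c)"
  proof (rule mvps_eqI)
    fix M
    define S where "S M = {(K, L). K + L = (M :: nat multiset)}" for M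
    have fin: "finite (S M)" for M
      by (simp add: S_def finite_multiset_splits)
    have S_iff: "(K, L) \<in> S M \<longleftrightarrow> K + L = M" for K L M
      by (simp add: S_def)
    have "mcoeff (a * b * c) M =
        (\<Sum>(N, L)\<in>S M. \<Sum>(K, J)\<in>S N. mcoeff a K * mcoeff b J * mcoeff c L)"
      by (simp add: times_mvps.rep_eq S_def[symmetric] sum_distrib_right case_prod_beta)
    also have "\<dots> = (\<Sum>x\<in>(SIGMA p : S M. S (fst p)).
        mcoeff a (fst (snd x)) * mcoeff b (snd (snd x)) * mcoeff c (snd (fst x)))"
      by (simp add: sum.Sigma fin case_prod_beta)
    also have "\<dots> = (\<Sum>x\<in>(SIGMA p : S M. S (snd p)).
        mcoeff a (fst (fst x)) * (mcoeff b (fst (snd x)) * mcoeff c (snd (snd x))))"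
      by (rule sum.reindex_bij_witness[where
            i = "\<lambda>((K, N), (J, L)). ((K + J, L), (K, J))" and
            j = "\<lambda>((N, L), (K, J)). ((K, J + L), (J, L))"])
         (auto simp: S_iff algebra_simps)
    also have "\<dots> = (\<Sum>(K, N)\<in>S M. \<Sum>(J, L)\<in>S N. mcoeff a K * (mcoeff b J * mcoeff c L))"
      by (simp add: sum.Sigma fin case_prod_beta)
    also have "\<dots> = mcoeff (a * (b * c)) M"
      by (simp add: times_mvps.rep_eq S_def[symmetric] sum_distrib_left case_prod_beta)
    finally show "mcoeff (a * b * c) M = mcoeff (a * (b * c)) M" .
  qed
  show "a * b = b * a"
  proof (rule mvps_eqI)
    fix M
    show "mcoeff (a * b) M = mcoeff (b * a) M"
      unfolding times_mvps.rep_eq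
      by (rule sum.reindex_bij_witness[where i = prod.swap and j = prod.swap])
         (auto simp: algebra_simps)
  qed
  show "1 * a = a"
  proof (rule mvps_eqI)
    fix M
    have "mcoeff (1 * a) M = (\<Sum>(K, L)\<in>{({#}, M)}. mcoeff 1 K * mcoeff a L)"
      unfolding times_mvps.rep_eq
      by (rule sum.mono_neutral_right) (auto simp: finite_multiset_splits one_mvps.rep_eq split: if_splits)
    then show "mcoeff (1 * a) M = mcoeff a M" by (simp add: one_mvps.rep_eq)
  qed
  show "(a + b) * c = a * c + b * c"
    by (rule mvps_eqI)
       (simp add: times_mvps.rep_eq plus_mvps.rep_eq case_prod_beta distrib_right sum.distrib)
  show "(0 :: 'a mvps) \<noteq> 1"
    by transfer (auto simp: fun_eq_iff)
qed (transfer; simp add: fun_eq_iff algebra_simps; fail)+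

end

lift_definition mvar :: "nat \<Rightarrow> 'a :: comm_ring_1 mvps" is "\<lambda>i M. if M = {#i#} then 1 else 0" .

text \<open>
  The sum of a possibly infinite family, taken coefficientwise. It is the intended formal sum
  for summable families, i.e.\ those in which each monomial occurs in only finitely many
  members; this is the case for the families below.
\<close>

definition formal_sum :: "('i \<Rightarrow> 'a :: comm_ring_1 mvps) \<Rightarrow> 'i set \<Rightarrow> 'a mvps" where
  "formal_sum f S = Abs_mvps (\<lambda>M. \<Sum>i | i \<in> S \<and> mcoeff (f i) M \<noteq> 0. mcoeff (f i) M)"

definition power_sum :: "nat \<Rightarrow> int mvps" where
  "power_sum k = formal_sum (\<lambda>i. mvar i ^ k) {i. 0 < i}"

text \<open>Partitions are encoded as multisets of their entries.\<close>

definition power_sum_partition :: "nat multiset \<Rightarrow> int mvps" where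
  "power_sum_partition \<mu> = (\<Prod>k\<in>#\<mu>. power_sum k)"

text \<open>
  The list \<open>is\<close> stands for \<open>(i\<^sub>1, \<dots>, i\<^sub>n)\<close>, so the entry with (1-based) position \<open>p\<close> is \<open>is ! (p - 1)\<close>.
\<close>

definition fundamental_qsym :: "nat set \<Rightarrow> nat \<Rightarrow> int mvps" where
  "fundamental_qsym I n =
    formal_sum (\<lambda>is. \<Prod>i\<leftarrow>is. mvar i)
      {is. length is = n \<and> (\<forall>i\<in>set is. 0 < i) \<and> sorted is \<and> (\<forall>p\<in>I. is ! (p - 1) < is ! p)}"


subsection \<open>Summability of the families used above\<close>

lemma mcoeff_prod_list_mvar:
  "mcoeff (\<Prod>i\<leftarrow>is. mvar i) M = (if M = mset is then 1 else 0 :: 'a :: comm_ring_1)"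
proof (induction "is" arbitrary: M)
  case Nil
  then show ?case by (simp add: one_mvps.rep_eq)
next
  case (Cons i "is")
  have "mcoeff (mvar i * (\<Prod>i\<leftarrow>is. mvar i)) M =
      (\<Sum>(K, L)\<in>{(K, L). K + L = M}. if K = {#i#} \<and> L = mset is then 1 else 0 :: 'a)"
    unfolding times_mvps.rep_eq by (rule sum.cong) (auto simp: Cons.IH mvar.rep_eq)
  also have "\<dots> = (\<Sum>(K, L)\<in>{(K, L). K + L = M} \<inter> {({#i#}, mset is)}. 1)"
    by (rule sum.mono_neutral_cong_right) (auto simp: finite_multiset_splits split: if_splits)
  also have "\<dots> = (if M = mset (i # is) then 1 else 0)"
    by (auto simp: Int_insert_right)
  finally show ?case by simp
qed

lemma fundamental_qsym_summable:
  "finite {is. is \<in> S \<and> mcoeff (\<Prod>i\<leftarrow>is. mvar i :: 'a :: comm_ring_1 mvps) M \<noteq> 0}"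
proof -
  obtain xs where xs: "mset xs = M" using ex_mset by blast
  show ?thesis
    by (rule finite_subset[OF _ mset_eq_finite[of xs]])
       (auto simp: mcoeff_prod_list_mvar xs split: if_splits)
qed

lemma mcoeff_mvar_power:
  "mcoeff (mvar i ^ k) M = (if M = replicate_mset k i then 1 else 0 :: 'a :: comm_ring_1)"
  using mcoeff_prod_list_mvar[of "replicate k i" M] by (simp add: prod_list_replicate)

lemma power_sum_summable:
  assumes "0 < k"
  shows "finite {i. i \<in> S \<and> mcoeff (mvar i ^ k :: 'a :: comm_ring_1 mvps) M \<noteq> 0}"
  by (rule finite_subset[of _ "set_mset M"])
     (use assms in \<open>auto simp: mcoeff_mvar_power split: if_splits\<close>)


section \<open>Digraphs\<close>

definition digraph_complement :: "'a pair_pre_digraph \<Rightarrow> 'a pair_pre_digraph" where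
  "digraph_complement D = \<lparr> pverts = pverts D, parcs = (pverts D \<times> pverts D) - parcs D \<rparr>"

definition Des :: "'a list \<Rightarrow> 'a pair_pre_digraph \<Rightarrow> nat set" where
  "Des w D = {i \<in> {1..length w - 1}. (w ! (i - 1), w ! i) \<in> parcs D}"

text \<open>The \<open>V\<close>-listings are the elements of \<open>permutations_of_set V\<close>.\<close>

definition redei_berge :: "'a pair_pre_digraph \<Rightarrow> int mvps" where
  "redei_berge D =
    (\<Sum>w\<in>permutations_of_set (pverts D). fundamental_qsym (Des w D) (card (pverts D)))"


section \<open>Cycles\<close>

definition rotation_class :: "'a list \<Rightarrow> 'a list set" where
  "rotation_class xs = {rotate k xs | k. True}"

definition cyc_length :: "'a list set \<Rightarrow> nat" where
  "cyc_length \<gamma> = the_elem (length ` \<gamma>)"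

definition cyc_arcs_tuple :: "'a list \<Rightarrow> ('a \<times> 'a) set" where
  "cyc_arcs_tuple xs = set (zip xs (rotate1 xs))"

definition cyc_arcs :: "'a list set \<Rightarrow> ('a \<times> 'a) set" where
  "cyc_arcs \<gamma> = the_elem (cyc_arcs_tuple ` \<gamma>)"

lemma cyc_length_rotation_class: "cyc_length (rotation_class xs) = length xs"
proof -
  have "length ` rotation_class xs = {length xs}"
    unfolding rotation_class_def by (auto simp: image_iff) (metis length_rotate)
  then show ?thesis by (simp add: cyc_length_def)
qed

lemma cyc_arcs_rotation_class: "cyc_arcs (rotation_class xs) = cyc_arcs_tuple xs"
proof -
  have 1: "cyc_arcs_tuple (rotate1 ys) = cyc_arcs_tuple ys" for ys :: "'a list"
  proof -
    have "zip (rotate1 ys) (rotate1 (rotate1 ys)) = rotate1 (zip ys (rotate1 ys))"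
    proof (rule nth_equalityI)
      fix i assume "i < length (zip (rotate1 ys) (rotate1 (rotate1 ys)))"
      then have "i < length ys" "Suc i mod length ys < length ys"
        by (auto intro: mod_less_divisor)
      then show "zip (rotate1 ys) (rotate1 (rotate1 ys)) ! i = rotate1 (zip ys (rotate1 ys)) ! i"
        by (simp add: nth_rotate1)
    qed simp
    then show ?thesis by (simp add: cyc_arcs_tuple_def)
  qed
  have "cyc_arcs_tuple (rotate k xs) = cyc_arcs_tuple xs" for k
    by (induction k) (simp_all add: 1)
  then have "cyc_arcs_tuple ` rotation_class xs = {cyc_arcs_tuple xs}"
    by (auto simp: rotation_class_def image_iff)
  then show ?thesis by (simp add: cyc_arcs_def)
qed

text \<open>\<open>support \<sigma> i\<close> is the tuple \<open>(i, \<sigma> i, \<dots>, \<sigma>\<^sup>k\<^sup>-\<^sup>1 i)\<close> with \<open>k > 0\<close> least such that \<open>\<sigma>\<^sup>k i = i\<close>.\<close>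

definition perm_cycles :: "'a set \<Rightarrow> ('a \<Rightarrow> 'a) \<Rightarrow> 'a list set set" where
  "perm_cycles V \<sigma> = {rotation_class (support \<sigma> i) | i. i \<in> V}"

definition perm_type :: "'a set \<Rightarrow> ('a \<Rightarrow> 'a) \<Rightarrow> nat multiset" where
  "perm_type V \<sigma> = {#cyc_length \<gamma>. \<gamma> \<in># mset_set (perm_cycles V \<sigma>)#}"

definition digraph_cycles :: "'a pair_pre_digraph \<Rightarrow> 'a list set set" where
  "digraph_cycles D =
    {rotation_class v | v. v \<noteq> [] \<and> distinct v \<and> set v \<subseteq> pverts D \<and>
       cyc_arcs (rotation_class v) \<subseteq> parcs D}"

definition digraph_perms :: "'a pair_pre_digraph \<Rightarrow> ('a \<Rightarrow> 'a) set" where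
  "digraph_perms D =
    {\<sigma>. \<sigma> permutes pverts D \<and>
       (\<forall>\<gamma>\<in>perm_cycles (pverts D) \<sigma>.
          \<gamma> \<in> digraph_cycles D \<or> \<gamma> \<in> digraph_cycles (digraph_complement D))}"

definition phi :: "'a pair_pre_digraph \<Rightarrow> ('a \<Rightarrow> 'a) \<Rightarrow> nat" where
  "phi D \<sigma> = (\<Sum>\<gamma> | \<gamma> \<in> perm_cycles (pverts D) \<sigma> \<and> \<gamma> \<in> digraph_cycles D. cyc_length \<gamma> - 1)"

end

theory Submission
  imports Defs "HOL-Combinatorics.Orbits" "HOL-Library.Sublist"
begin

text \<open>
  For arbitrary arc weights \<open>a\<close> on a finite set \<open>V\<close>, summing over \<open>V\<close>-listings \<open>w\<close> and over
  permutations \<open>\<sigma>\<close> of \<open>V\<close>,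
  \[ \sum_w \prod_i (1 + a(w_i, w_{i+1}))
     = \sum_\sigma \prod_{\gamma} \Bigl(\prod_{x \in \gamma} (1 + a(x, \sigma x)) - \prod_{x \in \gamma} a(x, \sigma x)\Bigr), \]
  where \<open>\<gamma>\<close> runs over the cycles of \<open>\<sigma>\<close>. Both sides are affine in each \<open>a(u, v)\<close> with \<open>u \<noteq> v\<close>,
  and the coefficient of \<open>a(u, v)\<close> is the same expression on \<open>V - {v}\<close>, with the arcs leaving \<open>v\<close> now
  leaving \<open>u\<close>; so deletion and contraction reduce to weights that vanish off the diagonal, where
  both sides equal \<open>n!\<close>.

  Both \<open>U\<^sub>D\<close> and the power sums are formal sums, over colourings \<open>f\<close> of \<open>V\<close> by positive integers, of
  the monomials \<open>\<Prod>\<^sub>v x\<^bsub>f v\<^esub>\<close>. For fixed \<open>f\<close> let \<open>a(x, y) = 0\<close> if \<open>y\<close> may follow \<open>x\<close>, that is if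
  \<open>f x < f y\<close>, or \<open>f x = f y\<close> and \<open>(x, y)\<close> is not an arc, and \<open>a(x, y) = -1\<close> otherwise. The left-hand
  side then counts the listings that contribute \<open>f\<close> to \<open>U\<^sub>D\<close>. On the right-hand side, a cycle on which
  \<open>f\<close> is not constant has both an ascent and a descent of \<open>f\<close>, so both of its products vanish; a
  cycle on which \<open>f\<close> is constant contributes \<open>(-1)\<^sup>\<ell>\<^sup>-\<^sup>1\<close>, \<open>1\<close> or \<open>0\<close> according to whether it is a cycle
  of \<open>D\<close>, of the complement, or of neither.
\<close>

section \<open>Formal sums\<close>

lemma mcoeff_sum: "mcoeff (\<Sum>i\<in>I. f i) M = (\<Sum>i\<in>I. mcoeff (f i) M)"
  by (induction I rule: infinite_finite_induct) (simp_all add: zero_mvps.rep_eq plus_mvps.rep_eq)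

lemma mcoeff_formal_sum:
  "mcoeff (formal_sum f S) M = (\<Sum>i | i \<in> S \<and> mcoeff (f i) M \<noteq> 0. mcoeff (f i) M)"
  by (simp add: formal_sum_def Abs_mvps_inverse)

lemma mcoeff_formal_sum_superset:
  assumes "finite T" "T \<subseteq> S" "{i \<in> S. mcoeff (f i) M \<noteq> 0} \<subseteq> T"
  shows "mcoeff (formal_sum f S) M = (\<Sum>i\<in>T. mcoeff (f i) M)"
  unfolding mcoeff_formal_sum using assms by (intro sum.mono_neutral_left) auto

lemma formal_sum_singleton [simp]: "formal_sum f {i} = f i"
proof (rule mvps_eqI)
  show "mcoeff (formal_sum f {i}) M = mcoeff (f i) M" for M
    by (subst mcoeff_formal_sum_superset[where T = "{i}"]) auto
qed

lemma formal_sum_filter: "formal_sum f {i \<in> S. P i} = formal_sum (\<lambda>i. of_bool (P i) * f i) S"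
proof (rule mvps_eqI)
  show "mcoeff (formal_sum f {i \<in> S. P i}) M =
      mcoeff (formal_sum (\<lambda>i. of_bool (P i) * f i) S) M" for M
    unfolding mcoeff_formal_sum
    by (rule sum.cong) (auto simp: zero_mvps.rep_eq of_bool_def split: if_splits)
qed

lemma formal_sum_reindex:
  assumes "bij_betw h S T"
  shows "formal_sum f T = formal_sum (f \<circ> h) S"
proof (rule mvps_eqI)
  fix M
  have "bij_betw h {i \<in> S. mcoeff ((f \<circ> h) i) M \<noteq> 0} {i \<in> T. mcoeff (f i) M \<noteq> 0}"
    using assms by (rule bij_betw_Collect) simp
  then show "mcoeff (formal_sum f T) M = mcoeff (formal_sum (f \<circ> h) S) M"
    unfolding mcoeff_formal_sum by (subst sum.reindex_bij_betw[symmetric]) auto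
qed

definition formally_summable :: "('i \<Rightarrow> 'a :: comm_ring_1 mvps) \<Rightarrow> 'i set \<Rightarrow> bool" where
  "formally_summable f S \<longleftrightarrow> (\<forall>M. finite {i \<in> S. mcoeff (f i) M \<noteq> 0})"

lemma formally_summable_finite: "finite S \<Longrightarrow> formally_summable f S"
  by (simp add: formally_summable_def)

lemma formally_summable_reindex:
  assumes "bij_betw h S T" "formally_summable (f \<circ> h) S"
  shows "formally_summable f T"
  unfolding formally_summable_def
proof
  fix M
  have "bij_betw h {i \<in> S. mcoeff ((f \<circ> h) i) M \<noteq> 0} {i \<in> T. mcoeff (f i) M \<noteq> 0}"
    using assms(1) by (rule bij_betw_Collect) simp
  then show "finite {i \<in> T. mcoeff (f i) M \<noteq> 0}"
    using assms(2) bij_betw_finite unfolding formally_summable_def by blast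
qed

lemma formal_sum_sum:
  assumes "\<And>j. j \<in> J \<Longrightarrow> formally_summable (f j) S"
  shows "formal_sum (\<lambda>i. \<Sum>j\<in>J. f j i) S = (\<Sum>j\<in>J. formal_sum (f j) S)"
proof (cases "finite J")
  case True
  show ?thesis
  proof (rule mvps_eqI)
    fix M
    define T where "T = (\<Union>j\<in>J. {i \<in> S. mcoeff (f j i) M \<noteq> 0})"
    have T: "finite T" "T \<subseteq> S"
      using True assms by (auto simp: T_def formally_summable_def)
    have "mcoeff (formal_sum (\<lambda>i. \<Sum>j\<in>J. f j i) S) M = (\<Sum>i\<in>T. \<Sum>j\<in>J. mcoeff (f j i) M)"
      using mcoeff_formal_sum_superset[OF T, of "\<lambda>i. \<Sum>j\<in>J. f j i" M]
      by (force simp: mcoeff_sum T_def dest: sum.not_neutral_contains_not_neutral)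
    also have "\<dots> = (\<Sum>j\<in>J. \<Sum>i\<in>T. mcoeff (f j i) M)"
      by (rule sum.swap)
    also have "\<dots> = (\<Sum>j\<in>J. mcoeff (formal_sum (f j) S) M)"
      by (intro sum.cong mcoeff_formal_sum_superset[OF T, symmetric]) (auto simp: T_def)
    finally show "mcoeff (formal_sum (\<lambda>i. \<Sum>j\<in>J. f j i) S) M = mcoeff (\<Sum>j\<in>J. formal_sum (f j) S) M"
      by (simp add: mcoeff_sum)
  qed
next
  case False
  then show ?thesis
    by (simp add: formal_sum_def zero_mvps.rep_eq flip: zero_mvps_def)
qed

lemma mcoeff_times_eq_0:
  assumes "\<And>K. K \<subseteq># M \<Longrightarrow> mcoeff f K = 0"
  shows "mcoeff (f * g) M = 0"
  unfolding times_mvps.rep_eq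
  by (rule sum.neutral) (auto simp: assms mset_subset_eq_add_left)

definition divisor_support :: "('i \<Rightarrow> 'a :: comm_ring_1 mvps) \<Rightarrow> 'i set \<Rightarrow> nat multiset \<Rightarrow> 'i set" where
  "divisor_support f S M = {i \<in> S. \<exists>K. K \<subseteq># M \<and> mcoeff (f i) K \<noteq> 0}"

lemma finite_divisor_support:
  assumes "formally_summable f S"
  shows "finite (divisor_support f S M)"
proof -
  have "{K. K \<subseteq># M} = fst ` {(K, L). K + L = M}"
    by (force simp: mset_subset_eq_exists_conv)
  then have "finite {K. K \<subseteq># M}"
    by (simp add: finite_multiset_splits)
  then have "finite (\<Union>K\<in>{K. K \<subseteq># M}. {i \<in> S. mcoeff (f i) K \<noteq> 0})"
    using assms by (auto simp: formally_summable_def)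
  then show ?thesis
    by (rule rev_finite_subset) (auto simp: divisor_support_def)
qed

lemma times_support_subset:
  "{p \<in> S \<times> T. mcoeff (case p of (s, t) \<Rightarrow> f s * g t) M \<noteq> 0} \<subseteq>
    divisor_support f S M \<times> divisor_support g T M"
  using mcoeff_times_eq_0[of M] by (fastforce simp: divisor_support_def mult.commute)

lemma formally_summable_Times:
  assumes "formally_summable f S" "formally_summable g T"
  shows "formally_summable (\<lambda>(s, t). f s * g t) (S \<times> T)"
  unfolding formally_summable_def
  using assms by (intro allI finite_subset[OF times_support_subset] finite_cartesian_product
    finite_divisor_support)

lemma formal_sum_times_formal_sum:
  assumes "formally_summable f S" "formally_summable g T"
  shows "formal_sum f S * formal_sum g T = formal_sum (\<lambda>(s, t). f s * g t) (S \<times> T)"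
proof (rule mvps_eqI)
  fix M :: "nat multiset"
  define A where "A = divisor_support f S M"
  define B where "B = divisor_support g T M"
  have fin: "finite A" "finite B"
    unfolding A_def B_def by (intro finite_divisor_support assms)+
  have f: "mcoeff (formal_sum f S) K = (\<Sum>s\<in>A. mcoeff (f s) K)" if "K \<subseteq># M" for K
    using fin that by (intro mcoeff_formal_sum_superset) (auto simp: A_def divisor_support_def)
  have g: "mcoeff (formal_sum g T) K = (\<Sum>t\<in>B. mcoeff (g t) K)" if "K \<subseteq># M" for K
    using fin that by (intro mcoeff_formal_sum_superset) (auto simp: B_def divisor_support_def)
  have "mcoeff (formal_sum f S * formal_sum g T) M =
      (\<Sum>(K, L) | K + L = M. \<Sum>(s, t)\<in>A \<times> B. mcoeff (f s) K * mcoeff (g t) L)"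
    unfolding times_mvps.rep_eq
    by (intro sum.cong) (auto simp: f g sum_product sum.cartesian_product)
  also have "\<dots> = (\<Sum>(s, t)\<in>A \<times> B. mcoeff (f s * g t) M)"
    by (simp add: case_prod_beta times_mvps.rep_eq) (rule sum.swap)
  also have "\<dots> = mcoeff (formal_sum (\<lambda>(s, t). f s * g t) (S \<times> T)) M"
  proof -
    have "A \<times> B \<subseteq> S \<times> T"
      by (auto simp: A_def B_def divisor_support_def)
    then show ?thesis
      using fin times_support_subset[of S T f g M, folded A_def B_def]
      by (subst mcoeff_formal_sum_superset[where T = "A \<times> B"]) (auto simp: case_prod_beta)
  qed
  finally show "mcoeff (formal_sum f S * formal_sum g T) M =
      mcoeff (formal_sum (\<lambda>(s, t). f s * g t) (S \<times> T)) M" .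
qed

lemma formally_summable_mult_left:
  assumes "formally_summable f S"
  shows "formally_summable (\<lambda>i. g i * f i) S"
  unfolding formally_summable_def
proof
  fix M
  have "{i \<in> S. mcoeff (g i * f i) M \<noteq> 0} \<subseteq> divisor_support f S M"
    using mcoeff_times_eq_0[of M] by (fastforce simp: divisor_support_def mult.commute)
  then show "finite {i \<in> S. mcoeff (g i * f i) M \<noteq> 0}"
    using finite_divisor_support[OF assms] by (rule finite_subset)
qed

lemma mult_formal_sum:
  assumes "formally_summable f S"
  shows "c * formal_sum f S = formal_sum (\<lambda>i. c * f i) S"
proof -
  have "c * formal_sum f S = formal_sum (\<lambda>(u, i). c * f i) ({()} \<times> S)"
    using formal_sum_times_formal_sum[OF formally_summable_finite assms, of "{()}" "\<lambda>_. c"] by simp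
  also have "\<dots> = formal_sum ((\<lambda>(u, i). c * f i) \<circ> Pair ()) S"
    by (rule formal_sum_reindex) (auto simp: bij_betw_def inj_on_def)
  finally show ?thesis
    by (simp add: comp_def)
qed

lemma bij_betw_PiE_insert:
  assumes "i \<notin> I"
  shows "bij_betw (\<lambda>(s, g). g(i := s)) (S i \<times> Pi\<^sub>E I S) (Pi\<^sub>E (insert i I) S)"
  using assms by (simp add: bij_betw_def inj_combinator PiE_insert_eq)

lemma prod_fun_upd_insert:
  assumes "finite I" "i \<notin> I"
  shows "(\<Prod>j\<in>insert i I. f j ((g(i := s)) j)) = f i s * (\<Prod>j\<in>I. f j (g j))"
proof -
  have "(\<Prod>j\<in>I. f j ((g(i := s)) j)) = (\<Prod>j\<in>I. f j (g j))"
    using assms by (intro prod.cong) auto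
  then show ?thesis
    using assms by simp
qed

lemma formally_summable_PiE:
  assumes "finite I" "\<And>i. i \<in> I \<Longrightarrow> formally_summable (f i) (S i)"
  shows "formally_summable (\<lambda>g. \<Prod>i\<in>I. f i (g i)) (Pi\<^sub>E I S)"
  using assms
proof (induction I rule: finite_induct)
  case empty
  show ?case
    by (simp add: formally_summable_finite)
next
  case (insert i I)
  have "formally_summable (\<lambda>(s, g). f i s * (\<Prod>j\<in>I. f j (g j))) (S i \<times> Pi\<^sub>E I S)"
    using insert by (intro formally_summable_Times) auto
  then show ?case
    using insert.hyps
    by (intro formally_summable_reindex[OF bij_betw_PiE_insert])
       (simp_all add: prod_fun_upd_insert comp_def split_def del: prod.insert fun_upd_apply)
qed

lemma prod_formal_sum:
  assumes "finite I" "\<And>i. i \<in> I \<Longrightarrow> formally_summable (f i) (S i)"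
  shows "(\<Prod>i\<in>I. formal_sum (f i) (S i)) = formal_sum (\<lambda>g. \<Prod>i\<in>I. f i (g i)) (Pi\<^sub>E I S)"
  using assms
proof (induction I rule: finite_induct)
  case empty
  show ?case
    by simp
next
  case (insert i I)
  have "(\<Prod>j\<in>insert i I. formal_sum (f j) (S j)) =
      formal_sum (f i) (S i) * formal_sum (\<lambda>g. \<Prod>j\<in>I. f j (g j)) (Pi\<^sub>E I S)"
    using insert by simp
  also have "\<dots> = formal_sum (\<lambda>(s, g). f i s * (\<Prod>j\<in>I. f j (g j))) (S i \<times> Pi\<^sub>E I S)"
    using insert by (intro formal_sum_times_formal_sum formally_summable_PiE) auto
  also have "\<dots> = formal_sum (\<lambda>g. \<Prod>j\<in>insert i I. f j (g j)) (Pi\<^sub>E (insert i I) S)"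
    unfolding formal_sum_reindex[OF bij_betw_PiE_insert[OF insert.hyps(2)]]
    using insert.hyps
    by (simp add: prod_fun_upd_insert comp_def split_def del: prod.insert fun_upd_apply)
  finally show ?case .
qed


section \<open>Deletion and contraction of weighted arcs\<close>

definition delete_arc :: "('a \<Rightarrow> 'a \<Rightarrow> 'b :: zero) \<Rightarrow> 'a \<Rightarrow> 'a \<Rightarrow> 'a \<Rightarrow> 'a \<Rightarrow> 'b" where
  "delete_arc a u v = a(u := (a u)(v := 0))"

definition contract_arc :: "('a \<Rightarrow> 'a \<Rightarrow> 'b) \<Rightarrow> 'a \<Rightarrow> 'a \<Rightarrow> 'a \<Rightarrow> 'a \<Rightarrow> 'b" where
  "contract_arc a u v = a(u := a v)"

lemma deletion_contraction_induct [consumes 1, case_names diagonal arc]: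
  fixes a :: "'a \<Rightarrow> 'a \<Rightarrow> 'b :: zero"
  assumes "finite V"
    and diagonal: "\<And>V a. finite V \<Longrightarrow> (\<And>x y. x \<in> V \<Longrightarrow> y \<in> V \<Longrightarrow> x \<noteq> y \<Longrightarrow> a x y = 0) \<Longrightarrow> P V a"
    and arc: "\<And>V a u v. finite V \<Longrightarrow> u \<in> V \<Longrightarrow> v \<in> V \<Longrightarrow> u \<noteq> v \<Longrightarrow>
      P V (delete_arc a u v) \<Longrightarrow> P (V - {v}) (contract_arc a u v) \<Longrightarrow> P V a"
  shows "P V a"
  using \<open>finite V\<close>
proof (induction "card V" arbitrary: V a rule: less_induct)
  case vertices: (less V a)
  define arcs where "arcs a = {(x, y) \<in> V \<times> V. x \<noteq> y \<and> a x y \<noteq> (0 :: 'b)}" for a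
  show ?case
  proof (induction "card (arcs a)" arbitrary: a rule: less_induct)
    case (less a)
    show ?case
    proof (cases "arcs a = {}")
      case True
      then show ?thesis
        using vertices.prems by (intro diagonal) (auto simp: arcs_def)
    next
      case False
      then obtain u v where uv: "u \<in> V" "v \<in> V" "u \<noteq> v" and "(u, v) \<in> arcs a"
        by (auto simp: arcs_def)
      have "finite (arcs a)"
        by (rule finite_subset[of _ "V \<times> V"]) (use vertices.prems in \<open>auto simp: arcs_def\<close>)
      moreover have "arcs (delete_arc a u v) = arcs a - {(u, v)}"
        by (auto simp: arcs_def delete_arc_def split: if_splits)
      ultimately have "card (arcs (delete_arc a u v)) < card (arcs a)"
        using \<open>(u, v) \<in> arcs a\<close> by (simp only: card_Diff1_less)
      then have "P V (delete_arc a u v)"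
        by (rule less.hyps)
      moreover have "P (V - {v}) (contract_arc a u v)"
        using vertices.prems uv(2) by (intro vertices.hyps card_Diff1_less) simp_all
      ultimately show ?thesis
        using arc[OF vertices.prems uv] by simp
    qed
  qed
qed

lemma sum_eq_sum_add_sum_reindex:
  fixes f f' :: "'i \<Rightarrow> 'b :: comm_monoid_add"
  assumes "finite A" "B \<subseteq> A" "bij_betw h B C"
    and outside: "\<And>x. x \<in> A - B \<Longrightarrow> f x = f' x"
    and inside: "\<And>x. x \<in> B \<Longrightarrow> f x = f' x + g (h x)"
  shows "sum f A = sum f' A + sum g C"
proof -
  have "sum f A = sum f (A - B) + sum f B"
    using assms(1,2) by (intro sum.subset_diff) auto
  also have "\<dots> = sum f' (A - B) + (sum f' B + (\<Sum>x\<in>B. g (h x)))"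
    using outside inside by (simp add: sum.distrib)
  also have "\<dots> = sum f' A + sum g C"
    using assms(1,2)
    by (simp add: sum.reindex_bij_betw[OF assms(3)] sum.subset_diff[of B A] add.assoc)
  finally show ?thesis .
qed


section \<open>Weights of listings\<close>

fun path_weight :: "('a \<Rightarrow> 'a \<Rightarrow> 'b :: comm_ring_1) \<Rightarrow> 'a list \<Rightarrow> 'b" where
  "path_weight a (x # y # xs) = (1 + a x y) * path_weight a (y # xs)"
| "path_weight a xs = 1"

lemma path_weight_append:
  "path_weight a (xs @ u # ys) = path_weight a (xs @ [u]) * path_weight a (u # ys)"
  by (induction xs rule: induct_list012) (auto simp: mult.assoc)

lemma path_weight_cong:
  assumes "\<And>x y. sublist [x, y] w \<Longrightarrow> a x y = b x y"
  shows "path_weight a w = path_weight b w"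
  using assms by (induction w rule: induct_list012) (simp_all add: sublist_Cons_right)

lemma path_weight_eq_1:
  assumes "\<And>x y. sublist [x, y] w \<Longrightarrow> a x y = 0"
  shows "path_weight a w = 1"
  using assms by (induction w rule: induct_list012) (simp_all add: sublist_Cons_right)

lemma path_weight_fun_upd_notin:
  assumes "u \<notin> set xs"
  shows "path_weight (a(u := r)) xs = path_weight a xs"
  using assms by (induction xs rule: induct_list012) auto

lemma path_weight_fun_upd_last:
  assumes "u \<notin> set xs"
  shows "path_weight (a(u := r)) (xs @ [u]) = path_weight a (xs @ [u])"
  using assms by (induction xs rule: induct_list012) auto

lemma path_weight_contract:
  assumes "distinct (xs @ u # v # ys)"
  shows "path_weight a (xs @ u # v # ys) =
    path_weight (delete_arc a u v) (xs @ u # v # ys) +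
    a u v * path_weight (contract_arc a u v) (xs @ u # ys)"
proof -
  have "u \<notin> set xs" "u \<notin> set (v # ys)" "u \<notin> set ys"
    using assms by auto
  moreover from this have "path_weight (contract_arc a u v) (u # ys) = path_weight a (v # ys)"
    by (cases ys) (simp_all add: contract_arc_def path_weight_fun_upd_notin)
  ultimately show ?thesis
    unfolding path_weight_append[of _ xs u "v # ys"] path_weight_append[of _ xs u ys]
    by (simp add: delete_arc_def contract_arc_def path_weight_fun_upd_last path_weight_fun_upd_notin
        algebra_simps)
qed

lemma remove1_after:
  assumes "distinct (xs @ u # v # ys)"
  shows "remove1 v (xs @ u # v # ys) = xs @ u # ys"
  using assms by (auto simp: remove1_append)

lemma inj_on_remove1_after: "inj_on (remove1 v) {w. distinct w \<and> sublist [u, v] w}"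
proof (rule inj_onI)
  fix w w' assume "w \<in> {w. distinct w \<and> sublist [u, v] w}" "w' \<in> {w. distinct w \<and> sublist [u, v] w}"
    and eq: "remove1 v w = remove1 v w'"
  then obtain xs ys xs' ys' where splits: "w = xs @ u # v # ys" "w' = xs' @ u # v # ys'"
    and distinct: "distinct w" "distinct w'"
    by (auto simp: sublist_def)
  then have "xs @ u # ys = xs' @ u # ys'"
    using eq by (simp only: remove1_after)
  moreover have "u \<notin> set xs" "u \<notin> set ys"
    using distinct(1) splits(1) by auto
  ultimately have "xs = xs' \<and> ys = ys'"
    using append_Cons_eq_iff[of u xs ys xs' ys'] by simp
  then show "w = w'"
    using splits by simp
qed

lemma bij_betw_remove1_listings:
  assumes "u \<in> V" "v \<in> V" "u \<noteq> v"
  shows "bij_betw (remove1 v) {w \<in> permutations_of_set V. sublist [u, v] w}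
    (permutations_of_set (V - {v}))"
proof (rule bij_betw_imageI)
  let ?P = "{w \<in> permutations_of_set V. sublist [u, v] w}"
  show "inj_on (remove1 v) ?P"
    by (rule inj_on_subset[OF inj_on_remove1_after[of v u]]) (auto simp: permutations_of_set_def)
  show "remove1 v ` ?P = permutations_of_set (V - {v})"
  proof
    show "remove1 v ` ?P \<subseteq> permutations_of_set (V - {v})"
      by (auto simp: permutations_of_set_def)
    show "permutations_of_set (V - {v}) \<subseteq> remove1 v ` ?P"
    proof
      fix w assume "w \<in> permutations_of_set (V - {v})"
      then have listing: "set w = V - {v}" "distinct w"
        by (auto simp: permutations_of_set_def)
      then obtain xs ys where split: "w = xs @ u # ys"
        using assms by (metis Diff_iff singletonD split_list)
      have "v \<notin> set w"
        using listing(1) by simp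
      then have distinct: "distinct (xs @ u # v # ys)"
        using listing(2) split assms(3) by simp
      have "set (xs @ u # v # ys) = insert v (set w)"
        using split by auto
      also have "\<dots> = V"
        unfolding listing(1) using assms(2) by (rule insert_Diff)
      finally have "xs @ u # v # ys \<in> permutations_of_set V"
        using distinct by (rule permutations_of_setI)
      moreover have "sublist [u, v] (xs @ u # v # ys)"
        using sublist_appendI[of "[u, v]" xs ys] by simp
      ultimately have "xs @ u # v # ys \<in> ?P"
        by simp
      then show "w \<in> remove1 v ` ?P"
        using remove1_after[OF distinct, symmetric] unfolding split by (rule rev_image_eqI)
    qed
  qed
qed

lemma sum_path_weight_contract:
  fixes a :: "'a \<Rightarrow> 'a \<Rightarrow> 'b :: comm_ring_1"
  assumes "finite V" "u \<in> V" "v \<in> V" "u \<noteq> v"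
  shows "(\<Sum>w\<in>permutations_of_set V. path_weight a w) =
    (\<Sum>w\<in>permutations_of_set V. path_weight (delete_arc a u v) w) +
    (\<Sum>w\<in>permutations_of_set (V - {v}). a u v * path_weight (contract_arc a u v) w)"
proof (rule sum_eq_sum_add_sum_reindex)
  let ?P = "{w \<in> permutations_of_set V. sublist [u, v] w}"
  show "bij_betw (remove1 v) ?P (permutations_of_set (V - {v}))"
    using assms(2-) by (rule bij_betw_remove1_listings)
  show "path_weight a w = path_weight (delete_arc a u v) w"
    if "w \<in> permutations_of_set V - ?P" for w
    by (rule path_weight_cong) (use that in \<open>auto simp: delete_arc_def\<close>)
  fix w assume "w \<in> ?P"
  then obtain xs ys where split: "w = xs @ u # v # ys" and distinct: "distinct (xs @ u # v # ys)"
    by (auto simp: sublist_def permutations_of_set_def)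
  show "path_weight a w = path_weight (delete_arc a u v) w +
      a u v * path_weight (contract_arc a u v) (remove1 v w)"
    unfolding split remove1_after[OF distinct] using distinct by (rule path_weight_contract)
qed auto


section \<open>Weights of permutations\<close>

lemma permutation_orbit_eq:
  assumes "permutation \<sigma>" "y \<in> orbit \<sigma> x"
  shows "orbit \<sigma> y = orbit \<sigma> x"
  using cyclic_on_orbit'[OF assms(1)] assms(2) by (rule orbit_cyclic_eq3)

lemma orbit_contract:
  assumes "permutation \<sigma>" "\<sigma> u = v" "u \<noteq> v"
  shows "orbit (\<sigma> \<circ> transpose u v) u = orbit \<sigma> u - {v}"
proof -
  define \<tau> where "\<tau> = \<sigma> \<circ> transpose u v"
  have \<tau>: "\<tau> u = \<sigma> v" "\<And>x. x \<noteq> u \<Longrightarrow> x \<noteq> v \<Longrightarrow> \<tau> x = \<sigma> x"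
    by (simp_all add: \<tau>_def)
  have not_v: "\<sigma> x \<noteq> v" if "x \<noteq> u" for x
    using that assms by (metis bij_is_inj inj_eq permutation_bijective)
  have "x \<in> orbit \<sigma> u - {v}" if "x \<in> orbit \<tau> u" for x
    using that
  proof induction
    case base
    show ?case
      using assms not_v[of v] by (auto simp: \<tau> intro: orbit.intros)
  next
    case (step y)
    then show ?case
      using assms(2,3) not_v[of y] not_v[of v] \<tau> by (cases "y = u") (auto intro: orbit.intros)
  qed
  moreover have "x \<noteq> v \<longrightarrow> x \<in> orbit \<tau> u" if "x \<in> orbit \<sigma> u" for x
    using that
  proof induction
    case (step y)
    then show ?case
      using assms(2) \<tau> orbit.base[of \<tau> u] orbit.step[of y \<tau> u]
      by (cases "y = u"; cases "y = v") auto
  qed (use assms(2) in simp)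
  ultimately show ?thesis
    by (auto simp: \<tau>_def)
qed

lemma orbit_contract_disjoint:
  assumes "permutation \<sigma>" "\<sigma> u = v" "x \<notin> orbit \<sigma> u"
  shows "orbit (\<sigma> \<circ> transpose u v) x = orbit \<sigma> x"
proof (rule orbit_cong)
  note self = permutation_self_in_orbit[OF assms(1)]
  show "x \<in> orbit \<sigma> x"
    by (rule self)
  fix s assume "s \<in> orbit \<sigma> x"
  then have "s \<notin> orbit \<sigma> u"
    using assms(3) permutation_orbit_eq[OF assms(1)] self by metis
  then have "s \<noteq> u" "s \<noteq> v"
    using self assms(2) orbit.base[of \<sigma> u] by auto
  then show "(\<sigma> \<circ> transpose u v) s = \<sigma> s"
    by simp
qed

lemma orbits_contract:
  assumes "finite V" "\<sigma> permutes V" "\<sigma> u = v" "u \<noteq> v" "u \<in> V"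
  shows "orbit (\<sigma> \<circ> transpose u v) ` (V - {v}) =
    insert (orbit \<sigma> u - {v}) (orbit \<sigma> ` V - {orbit \<sigma> u})"
proof -
  define \<tau> where "\<tau> = \<sigma> \<circ> transpose u v"
  have \<sigma>: "permutation \<sigma>"
    using assms(1,2) by (rule permutes_imp_permutation)
  then have \<tau>: "permutation \<tau>"
    unfolding \<tau>_def by (intro permutation_compose permutation_swap_id)
  note self = permutation_self_in_orbit[OF \<sigma>]
  have \<tau>_u: "orbit \<tau> u = orbit \<sigma> u - {v}"
    unfolding \<tau>_def using \<sigma> assms(3,4) by (rule orbit_contract)
  have "orbit \<tau> x = orbit \<sigma> u - {v}" if "x \<in> orbit \<sigma> u - {v}" for x
    using permutation_orbit_eq[OF \<tau>, of x u] that \<tau>_u by simp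
  moreover have "u \<in> orbit \<sigma> u - {v}"
    using self assms(4) by simp
  ultimately have meeting: "orbit \<tau> ` (V \<inter> (orbit \<sigma> u - {v})) = {orbit \<sigma> u - {v}}"
    using assms(5) by blast
  have "orbit \<tau> ` (V - orbit \<sigma> u) = orbit \<sigma> ` (V - orbit \<sigma> u)"
    unfolding \<tau>_def using orbit_contract_disjoint[OF \<sigma> assms(3)] by (intro image_cong) auto
  also have "\<dots> = orbit \<sigma> ` V - {orbit \<sigma> u}"
    using permutation_orbit_eq[OF \<sigma>] self by blast
  finally have disjoint: "orbit \<tau> ` (V - orbit \<sigma> u) = orbit \<sigma> ` V - {orbit \<sigma> u}" .
  have "V - {v} = (V \<inter> (orbit \<sigma> u - {v})) \<union> (V - orbit \<sigma> u)"
    using assms(3) orbit.base[of \<sigma> u] by auto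
  then show ?thesis
    using meeting disjoint by (simp add: image_Un flip: \<tau>_def)
qed

definition cycle_weight :: "('a \<Rightarrow> 'a \<Rightarrow> 'b :: comm_ring_1) \<Rightarrow> ('a \<Rightarrow> 'a) \<Rightarrow> 'a set \<Rightarrow> 'b" where
  "cycle_weight a \<sigma> C = (\<Prod>x\<in>C. 1 + a x (\<sigma> x)) - (\<Prod>x\<in>C. a x (\<sigma> x))"

definition permutation_weight :: "('a \<Rightarrow> 'a \<Rightarrow> 'b :: comm_ring_1) \<Rightarrow> 'a set \<Rightarrow> ('a \<Rightarrow> 'a) \<Rightarrow> 'b" where
  "permutation_weight a V \<sigma> = (\<Prod>C\<in>orbit \<sigma> ` V. cycle_weight a \<sigma> C)"

lemma cycle_weight_cong:
  assumes "\<And>x. x \<in> C \<Longrightarrow> a x (\<sigma> x) = b x (\<tau> x)"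
  shows "cycle_weight a \<sigma> C = cycle_weight b \<tau> C"
  using assms by (simp add: cycle_weight_def)

lemma cycle_weight_contract:
  fixes a :: "'a \<Rightarrow> 'a \<Rightarrow> 'b :: comm_ring_1"
  assumes "finite C" "u \<in> C" "v \<in> C" "u \<noteq> v" "\<sigma> u = v"
  shows "cycle_weight a \<sigma> C = cycle_weight (delete_arc a u v) \<sigma> C +
    a u v * cycle_weight (contract_arc a u v) (\<sigma> \<circ> transpose u v) (C - {v})"
proof -
  define R where "R = C - {u, v}"
  have split: "C = insert u (insert v R)" "C - {v} = insert u R" "finite R" "u \<notin> R" "v \<notin> R"
    using assms by (auto simp: R_def)
  have "(\<Prod>x\<in>R. 1 + delete_arc a u v x (\<sigma> x)) = (\<Prod>x\<in>R. 1 + a x (\<sigma> x))"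
    and "(\<Prod>x\<in>R. 1 + contract_arc a u v x ((\<sigma> \<circ> transpose u v) x)) = (\<Prod>x\<in>R. 1 + a x (\<sigma> x))"
    and "(\<Prod>x\<in>R. contract_arc a u v x ((\<sigma> \<circ> transpose u v) x)) = (\<Prod>x\<in>R. a x (\<sigma> x))"
    using split(4,5) by (auto intro!: prod.cong simp: delete_arc_def contract_arc_def transpose_def)
  moreover have "(\<Prod>x\<in>C. g x) = g u * (g v * (\<Prod>x\<in>R. g x))"
    and "(\<Prod>x\<in>C - {v}. g x) = g u * (\<Prod>x\<in>R. g x)" for g :: "'a \<Rightarrow> 'b"
    unfolding split(2) unfolding split(1) using split(3-) assms(4) by simp_all
  ultimately show ?thesis
    unfolding cycle_weight_def using assms(4,5)
    by (simp add: delete_arc_def contract_arc_def algebra_simps)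
qed

lemma permutation_weight_contract:
  assumes "finite V" "\<sigma> permutes V" "\<sigma> u = v" "u \<noteq> v" "u \<in> V"
  shows "permutation_weight a V \<sigma> = permutation_weight (delete_arc a u v) V \<sigma> +
    a u v * permutation_weight (contract_arc a u v) (V - {v}) (\<sigma> \<circ> transpose u v)"
proof -
  define \<tau> where "\<tau> = \<sigma> \<circ> transpose u v"
  define U where "U = orbit \<sigma> u"
  define R where "R = orbit \<sigma> ` V - {U}"
  have \<sigma>: "permutation \<sigma>"
    using assms(1,2) by (rule permutes_imp_permutation)
  have cycle: "u \<in> U" "v \<in> U" "finite U"
    using permutation_self_in_orbit[OF \<sigma>] orbit.base[of \<sigma> u] finite_orbit[of u \<sigma>] assms(3)
    by (auto simp: U_def)
  have avoid: "u \<notin> C" "v \<notin> C" if "C \<in> R" for C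
  proof -
    have "C = U" if "y \<in> U" "y \<in> C" for y
      using \<open>C \<in> R\<close> that permutation_orbit_eq[OF \<sigma>, of y] by (auto simp: R_def U_def)
    then show "u \<notin> C" "v \<notin> C"
      using that cycle by (auto simp: R_def)
  qed
  have rest: "finite R" "U \<notin> R" "U - {v} \<notin> R"
    using assms(1,4) cycle(1) avoid(1)[of "U - {v}"] by (auto simp: R_def)
  have orbits: "orbit \<sigma> ` V = insert U R" "orbit \<tau> ` (V - {v}) = insert (U - {v}) R"
    using assms(5) orbits_contract[OF assms] by (auto simp: R_def U_def \<tau>_def)
  have "cycle_weight (delete_arc a u v) \<sigma> C = cycle_weight a \<sigma> C"
    "cycle_weight (contract_arc a u v) \<tau> C = cycle_weight a \<sigma> C" if "C \<in> R" for C
    using avoid[OF that]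
    by (auto intro!: cycle_weight_cong simp: delete_arc_def contract_arc_def \<tau>_def transpose_def)
  moreover have "cycle_weight a \<sigma> U =
      cycle_weight (delete_arc a u v) \<sigma> U + a u v * cycle_weight (contract_arc a u v) \<tau> (U - {v})"
    unfolding \<tau>_def using cycle(3,1,2) assms(4,3) by (rule cycle_weight_contract)
  ultimately show ?thesis
    unfolding \<tau>_def[symmetric] permutation_weight_def orbits using rest by (simp add: algebra_simps)
qed

lemma bij_betw_comp_transpose:
  assumes "u \<in> V" "v \<in> V" "u \<noteq> v"
  shows "bij_betw (\<lambda>\<sigma>. \<sigma> \<circ> transpose u v) {\<sigma>. \<sigma> permutes V \<and> \<sigma> u = v} {\<tau>. \<tau> permutes (V - {v})}"
proof (rule bij_betw_byWitness[where f' = "\<lambda>\<tau>. \<tau> \<circ> transpose u v"])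
  have permutes: "\<sigma> \<circ> transpose u v permutes V" if "\<sigma> permutes V" for \<sigma>
    using permutes_compose[OF permutes_swap_id[OF assms(1,2)] that] .
  have "\<sigma> \<circ> transpose u v permutes V - {v}" if "\<sigma> permutes V" "\<sigma> u = v" for \<sigma>
    using permutes[OF that(1)] by (rule permutes_superset) (use that(2) in auto)
  then show "(\<lambda>\<sigma>. \<sigma> \<circ> transpose u v) ` {\<sigma>. \<sigma> permutes V \<and> \<sigma> u = v} \<subseteq> {\<tau>. \<tau> permutes (V - {v})}"
    by blast
  show "(\<lambda>\<tau>. \<tau> \<circ> transpose u v) ` {\<tau>. \<tau> permutes (V - {v})} \<subseteq> {\<sigma>. \<sigma> permutes V \<and> \<sigma> u = v}"
    using permutes permutes_subset[of _ "V - {v}" V] by (auto simp: permutes_not_in)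
qed (simp_all add: comp_assoc)

lemma sum_permutation_weight_contract:
  fixes a :: "'a \<Rightarrow> 'a \<Rightarrow> 'b :: comm_ring_1"
  assumes "finite V" "u \<in> V" "v \<in> V" "u \<noteq> v"
  shows "(\<Sum>\<sigma> | \<sigma> permutes V. permutation_weight a V \<sigma>) =
    (\<Sum>\<sigma> | \<sigma> permutes V. permutation_weight (delete_arc a u v) V \<sigma>) +
    (\<Sum>\<tau> | \<tau> permutes (V - {v}). a u v * permutation_weight (contract_arc a u v) (V - {v}) \<tau>)"
proof (rule sum_eq_sum_add_sum_reindex)
  let ?P = "{\<sigma>. \<sigma> permutes V \<and> \<sigma> u = v}"
  show "finite {\<sigma>. \<sigma> permutes V}"
    using assms(1) by (rule finite_permutations)
  show "bij_betw (\<lambda>\<sigma>. \<sigma> \<circ> transpose u v) ?P {\<tau>. \<tau> permutes (V - {v})}"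
    using assms(2-) by (rule bij_betw_comp_transpose)
  show "permutation_weight a V \<sigma> = permutation_weight (delete_arc a u v) V \<sigma>"
    if "\<sigma> \<in> {\<sigma>. \<sigma> permutes V} - ?P" for \<sigma>
    unfolding permutation_weight_def
    by (intro prod.cong cycle_weight_cong refl) (use that in \<open>auto simp: delete_arc_def\<close>)
  show "permutation_weight a V \<sigma> = permutation_weight (delete_arc a u v) V \<sigma> +
      a u v * permutation_weight (contract_arc a u v) (V - {v}) (\<sigma> \<circ> transpose u v)"
    if "\<sigma> \<in> ?P" for \<sigma>
    using that assms by (intro permutation_weight_contract) auto
qed auto

lemma permutation_weight_diagonal:
  assumes "finite V" "\<sigma> permutes V"
    and diagonal: "\<And>x y. x \<in> V \<Longrightarrow> y \<in> V \<Longrightarrow> x \<noteq> y \<Longrightarrow> a x y = 0"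
  shows "permutation_weight a V \<sigma> = 1"
  unfolding permutation_weight_def
proof (intro prod.neutral ballI)
  fix C assume "C \<in> orbit \<sigma> ` V"
  then obtain x where x: "x \<in> V" "C = orbit \<sigma> x" by auto
  have \<sigma>: "permutation \<sigma>"
    using assms(1,2) by (rule permutes_imp_permutation)
  show "cycle_weight a \<sigma> C = 1"
  proof (cases "\<sigma> x = x")
    case True
    then have "C = {x}"
      using x by (simp add: orbit_eq_singleton_iff)
    then show ?thesis
      by (simp add: cycle_weight_def)
  next
    case False
    have orbit: "x \<in> C" "finite C" "C \<subseteq> V"
      using x permutation_self_in_orbit[OF \<sigma>] finite_orbit[OF permutation_self_in_orbit[OF \<sigma>]]
        permutes_orbit_subset[OF assms(2)] by auto
    have "a y (\<sigma> y) = 0" if "y \<in> C" for y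
    proof (rule diagonal)
      show "y \<noteq> \<sigma> y"
        using False that x orbit(1) permutation_orbit_eq[OF \<sigma>, of y x] orbit_eq_singleton_iff[of \<sigma> y]
        by auto
      show "y \<in> V" "\<sigma> y \<in> V"
        using that orbit(3) permutes_in_image[OF assms(2)] by auto
    qed
    then show ?thesis
      using orbit by (auto simp: cycle_weight_def power_0_left)
  qed
qed

theorem sum_path_weight_eq_sum_permutation_weight:
  fixes a :: "'a \<Rightarrow> 'a \<Rightarrow> 'b :: comm_ring_1"
  assumes "finite V"
  shows "(\<Sum>w\<in>permutations_of_set V. path_weight a w) =
    (\<Sum>\<sigma> | \<sigma> permutes V. permutation_weight a V \<sigma>)"
  using assms
proof (induction V a rule: deletion_contraction_induct)
  case (diagonal V a)
  have "path_weight a w = 1" if "w \<in> permutations_of_set V" for w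
    using that
    by (intro path_weight_eq_1 diagonal(2)) (auto simp: sublist_def permutations_of_set_def)
  then have "(\<Sum>w\<in>permutations_of_set V. path_weight a w) = of_nat (fact (card V))"
    using diagonal(1) by simp
  also have "\<dots> = (\<Sum>\<sigma> | \<sigma> permutes V. permutation_weight a V \<sigma>)"
    using diagonal by (simp add: permutation_weight_diagonal card_permutations)
  finally show ?case .
next
  case (arc V a u v)
  then show ?case
    by (simp add: sum_path_weight_contract[of V u v a] sum_permutation_weight_contract[of V u v a]
        flip: sum_distrib_left)
qed


section \<open>Cycles of a permutation as orbits\<close>

lemma set_support_eq_orbit:
  assumes "permutation \<sigma>"
  shows "set (support \<sigma> x) = orbit \<sigma> x"
  unfolding support_set[OF assms] orbit_altdef_permutation[OF assms] by auto

lemma least_power_eq_card_orbit: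
  assumes "permutation \<sigma>"
  shows "least_power \<sigma> x = card (orbit \<sigma> x)"
  using distinct_card[OF cycle_of_permutation[OF assms, of x]] set_support_eq_orbit[OF assms, of x]
  by simp

lemma rotate1_support:
  assumes "permutation \<sigma>"
  shows "rotate1 (support \<sigma> x) = map \<sigma> (support \<sigma> x)"
proof (rule nth_equalityI)
  fix i assume "i < length (rotate1 (support \<sigma> x))"
  then have i: "i < least_power \<sigma> x" by simp
  then have "Suc i mod least_power \<sigma> x < least_power \<sigma> x" by simp
  then show "rotate1 (support \<sigma> x) ! i = map \<sigma> (support \<sigma> x) ! i"
    using i funpow_mod_eq[OF least_power_of_permutation(1)[OF assms, of x], of "Suc i"]
    by (simp add: nth_rotate1)
qed simp

lemma support_apply:
  assumes "permutation \<sigma>"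
  shows "support \<sigma> (\<sigma> x) = rotate1 (support \<sigma> x)"
  unfolding rotate1_support[OF assms]
  by (simp add: least_power_eq_card_orbit[OF assms] permutation_orbit_step[OF assms] funpow_swap1)

lemma rotation_class_rotate1: "rotation_class (rotate1 xs) = rotation_class xs"
proof -
  have step: "rotate k (rotate1 xs) = rotate (Suc k) xs" for k
    by (simp add: rotate1_rotate_swap)
  have "\<exists>j. rotate k xs = rotate j (rotate1 xs)" for k
  proof (cases "length xs")
    case (Suc m)
    then have "rotate k xs = rotate (Suc (m + k)) xs"
      by (metis add_Suc mod_add_self1 rotate_conv_mod)
    then show ?thesis
      using step by metis
  qed simp
  then show ?thesis
    unfolding rotation_class_def using step by (metis (no_types, lifting))
qed

lemma rotation_class_support_eq:
  assumes "permutation \<sigma>" "y \<in> orbit \<sigma> x"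
  shows "rotation_class (support \<sigma> y) = rotation_class (support \<sigma> x)"
  using assms(2) by induction (simp_all add: support_apply[OF assms(1)] rotation_class_rotate1)

definition cycle_verts :: "'a list set \<Rightarrow> 'a set" where
  "cycle_verts \<gamma> = (\<Union>xs\<in>\<gamma>. set xs)"

lemma cycle_verts_rotation_class: "cycle_verts (rotation_class xs) = set xs"
  by (auto simp: cycle_verts_def rotation_class_def)

lemma cycle_verts_support:
  assumes "permutation \<sigma>"
  shows "cycle_verts (rotation_class (support \<sigma> x)) = orbit \<sigma> x"
  unfolding cycle_verts_rotation_class using assms by (rule set_support_eq_orbit)

lemma bij_betw_cycle_verts:
  assumes "permutation \<sigma>"
  shows "bij_betw cycle_verts (perm_cycles V \<sigma>) (orbit \<sigma> ` V)"
proof -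
  have "inj_on cycle_verts (perm_cycles V \<sigma>)"
  proof (rule inj_onI)
    fix \<gamma> \<delta> assume "\<gamma> \<in> perm_cycles V \<sigma>" "\<delta> \<in> perm_cycles V \<sigma>" "cycle_verts \<gamma> = cycle_verts \<delta>"
    then obtain x y where eqs: "\<gamma> = rotation_class (support \<sigma> x)" "\<delta> = rotation_class (support \<sigma> y)"
      and "orbit \<sigma> x = orbit \<sigma> y"
      unfolding perm_cycles_def using cycle_verts_support[OF assms] by blast
    then have "x \<in> orbit \<sigma> y"
      using permutation_self_in_orbit[OF assms, of x] by simp
    then show "\<gamma> = \<delta>"
      unfolding eqs by (rule rotation_class_support_eq[OF assms])
  qed
  moreover have "perm_cycles V \<sigma> = (\<lambda>x. rotation_class (support \<sigma> x)) ` V"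
    by (auto simp: perm_cycles_def)
  then have "cycle_verts ` perm_cycles V \<sigma> = orbit \<sigma> ` V"
    by (simp only: image_image cycle_verts_support[OF assms])
  ultimately show ?thesis
    by (simp add: bij_betw_def)
qed

lemma cyc_length_eq_card_cycle_verts:
  assumes "permutation \<sigma>" "\<gamma> \<in> perm_cycles V \<sigma>"
  shows "cyc_length \<gamma> = card (cycle_verts \<gamma>)"
proof -
  obtain x where \<gamma>: "\<gamma> = rotation_class (support \<sigma> x)"
    using assms(2) by (auto simp: perm_cycles_def)
  show ?thesis
    unfolding \<gamma> cyc_length_rotation_class cycle_verts_support[OF assms(1)]
    by (simp add: least_power_eq_card_orbit[OF assms(1)])
qed

definition perm_arcs :: "('a \<Rightarrow> 'a) \<Rightarrow> 'a set \<Rightarrow> ('a \<times> 'a) set" where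
  "perm_arcs \<sigma> C = (\<lambda>x. (x, \<sigma> x)) ` C"

lemma cyc_arcs_eq_perm_arcs:
  assumes "permutation \<sigma>" "\<gamma> \<in> perm_cycles V \<sigma>"
  shows "cyc_arcs \<gamma> = perm_arcs \<sigma> (cycle_verts \<gamma>)"
proof -
  obtain x where \<gamma>: "\<gamma> = rotation_class (support \<sigma> x)"
    using assms(2) by (auto simp: perm_cycles_def)
  have "set (zip xs (map \<sigma> xs)) = perm_arcs \<sigma> (set xs)" for xs
    unfolding perm_arcs_def by (induction xs) simp_all
  then show ?thesis
    unfolding \<gamma> cyc_arcs_rotation_class cyc_arcs_tuple_def rotate1_support[OF assms(1)]
      cycle_verts_rotation_class .
qed

lemma perm_cycle_in_digraph_cycles_iff:
  assumes "finite (pverts D)" "\<sigma> permutes pverts D" "\<gamma> \<in> perm_cycles (pverts D) \<sigma>"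
  shows "\<gamma> \<in> digraph_cycles D \<longleftrightarrow> perm_arcs \<sigma> (cycle_verts \<gamma>) \<subseteq> parcs D"
proof -
  have \<sigma>: "permutation \<sigma>"
    using assms(1,2) by (rule permutes_imp_permutation)
  obtain x where x: "\<gamma> = rotation_class (support \<sigma> x)" "x \<in> pverts D"
    using assms(3) by (auto simp: perm_cycles_def)
  have "support \<sigma> x \<noteq> []" "distinct (support \<sigma> x)"
    using least_power_of_permutation(2)[OF \<sigma>] cycle_of_permutation[OF \<sigma>] by auto
  moreover have "set (support \<sigma> x) \<subseteq> pverts D"
    unfolding set_support_eq_orbit[OF \<sigma>] using assms(2) x(2) by (rule permutes_orbit_subset)
  ultimately have "\<gamma> \<in> digraph_cycles D \<longleftrightarrow> cyc_arcs \<gamma> \<subseteq> parcs D"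
    using x(1) unfolding digraph_cycles_def by blast
  then show ?thesis
    unfolding cyc_arcs_eq_perm_arcs[OF \<sigma> assms(3)] .
qed

lemma perm_cycle_in_digraph_cycles_complement_iff:
  assumes "finite (pverts D)" "\<sigma> permutes pverts D" "\<gamma> \<in> perm_cycles (pverts D) \<sigma>"
  shows "\<gamma> \<in> digraph_cycles (digraph_complement D) \<longleftrightarrow> disjnt (perm_arcs \<sigma> (cycle_verts \<gamma>)) (parcs D)"
proof -
  have "cycle_verts \<gamma> \<in> orbit \<sigma> ` pverts D"
    using bij_betw_cycle_verts permutes_imp_permutation[OF assms(1,2)] assms(3)
    by (metis bij_betw_apply)
  then have "cycle_verts \<gamma> \<subseteq> pverts D"
    using permutes_orbit_subset[OF assms(2)] by blast
  then have "perm_arcs \<sigma> (cycle_verts \<gamma>) \<subseteq> pverts D \<times> pverts D"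
    using permutes_in_image[OF assms(2)] by (auto simp: perm_arcs_def)
  then show ?thesis
    using perm_cycle_in_digraph_cycles_iff[of "digraph_complement D"] assms
    by (auto simp: digraph_complement_def disjnt_def)
qed

lemma digraph_perms_iff_orbits:
  assumes "finite (pverts D)" "\<sigma> permutes pverts D"
  shows "\<sigma> \<in> digraph_perms D \<longleftrightarrow>
    (\<forall>C\<in>orbit \<sigma> ` pverts D. perm_arcs \<sigma> C \<subseteq> parcs D \<or> disjnt (perm_arcs \<sigma> C) (parcs D))"
  unfolding digraph_perms_def
    bij_betw_ball[OF bij_betw_cycle_verts[OF permutes_imp_permutation[OF assms]]]
  using assms perm_cycle_in_digraph_cycles_iff perm_cycle_in_digraph_cycles_complement_iff by blast

lemma phi_eq_sum_orbits:
  assumes "finite (pverts D)" "\<sigma> permutes pverts D"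
  shows "phi D \<sigma> = (\<Sum>C | C \<in> orbit \<sigma> ` pverts D \<and> perm_arcs \<sigma> C \<subseteq> parcs D. card C - 1)"
proof -
  have \<sigma>: "permutation \<sigma>"
    using assms by (rule permutes_imp_permutation)
  let ?\<Gamma> = "{\<gamma> \<in> perm_cycles (pverts D) \<sigma>. \<gamma> \<in> digraph_cycles D}"
  have "bij_betw cycle_verts ?\<Gamma> {C \<in> orbit \<sigma> ` pverts D. perm_arcs \<sigma> C \<subseteq> parcs D}"
    using assms
    by (intro bij_betw_Collect bij_betw_cycle_verts \<sigma>) (simp add: perm_cycle_in_digraph_cycles_iff)
  then have "(\<Sum>C | C \<in> orbit \<sigma> ` pverts D \<and> perm_arcs \<sigma> C \<subseteq> parcs D. card C - 1) =
      (\<Sum>\<gamma>\<in>?\<Gamma>. card (cycle_verts \<gamma>) - 1)"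
    by (rule sum.reindex_bij_betw[symmetric, where g = "\<lambda>C. card C - 1"])
  also have "\<dots> = phi D \<sigma>"
    unfolding phi_def by (intro sum.cong) (auto simp: cyc_length_eq_card_cycle_verts[OF \<sigma>])
  finally show ?thesis ..
qed

lemma power_sum_partition_perm_type_eq_prod_orbits:
  assumes "permutation \<sigma>"
  shows "power_sum_partition (perm_type V \<sigma>) = (\<Prod>C\<in>orbit \<sigma> ` V. power_sum (card C))"
proof -
  have "power_sum_partition (perm_type V \<sigma>) = (\<Prod>\<gamma>\<in>perm_cycles V \<sigma>. power_sum (cyc_length \<gamma>))"
    by (simp add: power_sum_partition_def perm_type_def image_mset.compositionality comp_def
        prod_unfold_prod_mset)
  also have "\<dots> = (\<Prod>\<gamma>\<in>perm_cycles V \<sigma>. power_sum (card (cycle_verts \<gamma>)))"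
    by (intro prod.cong refl) (simp add: cyc_length_eq_card_cycle_verts[OF assms])
  also have "\<dots> = (\<Prod>C\<in>orbit \<sigma> ` V. power_sum (card C))"
    by (rule prod.reindex_bij_betw[OF bij_betw_cycle_verts[OF assms]])
  finally show ?thesis .
qed


section \<open>Colourings\<close>

definition colour_monomial :: "'a set \<Rightarrow> ('a \<Rightarrow> nat) \<Rightarrow> 'b :: comm_ring_1 mvps" where
  "colour_monomial V f = (\<Prod>x\<in>V. mvar (f x))"

lemma formally_summable_colour_monomial:
  assumes "finite V"
  shows "formally_summable (colour_monomial V :: _ \<Rightarrow> 'b :: comm_ring_1 mvps) (V \<rightarrow>\<^sub>E S)"
  unfolding colour_monomial_def
proof (rule formally_summable_PiE[OF assms])
  show "formally_summable (mvar :: _ \<Rightarrow> 'b mvps) S"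
    using power_sum_summable[of 1, where 'a = 'b] by (simp add: formally_summable_def)
qed

definition admissible_step :: "('a \<times> 'a) set \<Rightarrow> ('a \<Rightarrow> nat) \<Rightarrow> 'a \<Rightarrow> 'a \<Rightarrow> bool" where
  "admissible_step A f x y \<longleftrightarrow> f x < f y \<or> f x = f y \<and> (x, y) \<notin> A"

definition step_weight :: "('a \<times> 'a) set \<Rightarrow> ('a \<Rightarrow> nat) \<Rightarrow> 'a \<Rightarrow> 'a \<Rightarrow> 'b :: comm_ring_1" where
  "step_weight A f x y = (if admissible_step A f x y then 0 else -1)"


subsection \<open>The fundamental quasisymmetric function of a listing\<close>

lemma path_weight_step_weight:
  "path_weight (step_weight A f) w = of_bool (successively (admissible_step A f) w)"
  by (induction w rule: induct_list012) (auto simp: step_weight_def)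

lemma ball_Des_iff:
  "(\<forall>p\<in>Des w D. P p) \<longleftrightarrow> (\<forall>i. Suc i < length w \<longrightarrow> (w ! i, w ! Suc i) \<in> parcs D \<longrightarrow> P (Suc i))"
proof -
  have "p \<in> Des w D \<longleftrightarrow> (\<exists>i. p = Suc i \<and> Suc i < length w \<and> (w ! i, w ! Suc i) \<in> parcs D)" for p
    by (cases p) (auto simp: Des_def)
  then show ?thesis
    by auto
qed

lemma successively_admissible_step_iff:
  "successively (admissible_step (parcs D) f) w \<longleftrightarrow>
    sorted (map f w) \<and> (\<forall>p\<in>Des w D. map f w ! (p - 1) < map f w ! p)"
  unfolding successively_conv_nth sorted_iff_nth_Suc ball_Des_iff admissible_step_def
  by (auto simp: order.order_iff_strict)

lemma bij_betw_map_PiE: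
  assumes "distinct w"
  shows "bij_betw (\<lambda>f. map f w) (set w \<rightarrow>\<^sub>E S) {xs. length xs = length w \<and> set xs \<subseteq> S}"
proof (rule bij_betw_imageI)
  show "inj_on (\<lambda>f. map f w) (set w \<rightarrow>\<^sub>E S)"
  proof (rule inj_onI)
    fix f g assume "f \<in> set w \<rightarrow>\<^sub>E S" "g \<in> set w \<rightarrow>\<^sub>E S" "map f w = map g w"
    then show "f = g"
      by (intro PiE_ext[of f "set w" "\<lambda>_. S" g]) simp_all
  qed
  show "(\<lambda>f. map f w) ` (set w \<rightarrow>\<^sub>E S) = {xs. length xs = length w \<and> set xs \<subseteq> S}"
  proof (intro equalityI subsetI)
    fix xs assume "xs \<in> {xs. length xs = length w \<and> set xs \<subseteq> S}"
    then have xs: "length xs = length w" "set xs \<subseteq> S" by auto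
    define f where "f = restrict (\<lambda>x. the (map_of (zip w xs) x)) (set w)"
    have map: "map f w = xs"
      using xs(1) assms by (intro nth_equalityI) (simp_all add: f_def map_of_zip_nth)
    then have "f ` set w \<subseteq> S"
      using xs(2) by auto
    then have "f \<in> set w \<rightarrow>\<^sub>E S"
      by (auto simp: PiE_iff f_def)
    then show "xs \<in> (\<lambda>f. map f w) ` (set w \<rightarrow>\<^sub>E S)"
      using map by blast
  qed auto
qed

lemma fundamental_qsym_Des:
  assumes "w \<in> permutations_of_set V"
  shows "fundamental_qsym (Des w D) (card V) =
    formal_sum (colour_monomial V) {f \<in> V \<rightarrow>\<^sub>E {0<..}. successively (admissible_step (parcs D) f) w}"
proof -
  have listing: "set w = V" "distinct w" "length w = card V"
    using assms by (auto simp: permutations_of_set_def distinct_card)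
  let ?P = "\<lambda>xs :: nat list. sorted xs \<and> (\<forall>p\<in>Des w D. xs ! (p - 1) < xs ! p)"
  have "bij_betw (\<lambda>f. map f w) {f \<in> V \<rightarrow>\<^sub>E {0<..}. successively (admissible_step (parcs D) f) w}
      {xs \<in> {xs. length xs = length w \<and> set xs \<subseteq> {0<..}}. ?P xs}"
    using bij_betw_map_PiE[OF listing(2), of "{0<..}"] unfolding listing(1)
    by (rule bij_betw_Collect) (simp only: successively_admissible_step_iff)
  moreover have "{xs \<in> {xs. length xs = length w \<and> set xs \<subseteq> {0<..}}. ?P xs} =
      {is. length is = card V \<and> (\<forall>i\<in>set is. 0 < i) \<and> sorted is \<and>
        (\<forall>p\<in>Des w D. is ! (p - 1) < is ! p)}"
    using listing(3) by auto
  ultimately have "fundamental_qsym (Des w D) (card V) =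
      formal_sum ((\<lambda>is. \<Prod>i\<leftarrow>is. mvar i) \<circ> (\<lambda>f. map f w))
        {f \<in> V \<rightarrow>\<^sub>E {0<..}. successively (admissible_step (parcs D) f) w}"
    unfolding fundamental_qsym_def by (simp only: formal_sum_reindex)
  moreover have "(\<Prod>i\<leftarrow>map f w. mvar i) = (colour_monomial V f :: int mvps)" for f
    unfolding colour_monomial_def listing(1)[symmetric] prod.distinct_set_conv_list[OF listing(2)]
    by (simp add: comp_def)
  ultimately show ?thesis
    by (simp only: comp_def)
qed


subsection \<open>The power sums of a permutation\<close>

lemma bij_betw_compose_fibres:
  "bij_betw (\<lambda>g. compose V g h) (h ` V \<rightarrow>\<^sub>E S)
    {f \<in> V \<rightarrow>\<^sub>E S. \<forall>x\<in>V. \<forall>y\<in>V. h x = h y \<longrightarrow> f x = f y}"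
proof (rule bij_betw_byWitness[where f' = "\<lambda>f. compose (h ` V) f (inv_into V h)"])
  let ?s = "inv_into V h" and ?F = "{f \<in> V \<rightarrow>\<^sub>E S. \<forall>x\<in>V. \<forall>y\<in>V. h x = h y \<longrightarrow> f x = f y}"
  have preimage: "?s c \<in> V" "h (?s c) = c" if "c \<in> h ` V" for c
    using that by (simp_all add: inv_into_into f_inv_into_f)
  show "\<forall>g\<in>h ` V \<rightarrow>\<^sub>E S. compose (h ` V) (compose V g h) ?s = g"
    by (auto intro!: extensionalityI[of _ "h ` V"] simp: PiE_iff compose_eq preimage)
  show "(\<lambda>g. compose V g h) ` (h ` V \<rightarrow>\<^sub>E S) \<subseteq> ?F"
    by (auto simp: PiE_iff compose_eq)
  show "\<forall>f\<in>?F. compose V (compose (h ` V) f ?s) h = f"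
  proof
    fix f assume f: "f \<in> ?F"
    have "f (?s (h x)) = f x" if "x \<in> V" for x
      using f that preimage[of "h x"] by blast
    moreover have "f \<in> extensional V"
      using f by (simp add: PiE_iff)
    ultimately show "compose V (compose (h ` V) f ?s) h = f"
      by (intro extensionalityI[of _ V]) (simp_all add: compose_eq)
  qed
  show "(\<lambda>f. compose (h ` V) f ?s) ` ?F \<subseteq> h ` V \<rightarrow>\<^sub>E S"
  proof (rule image_subsetI)
    fix f assume "f \<in> ?F"
    then have "f \<in> V \<rightarrow>\<^sub>E S" by blast
    then show "compose (h ` V) f ?s \<in> h ` V \<rightarrow>\<^sub>E S"
      by (auto simp: PiE_iff compose_eq preimage)
  qed
qed

lemma invariant_iff_constant_on_orbits:
  assumes "finite V" "\<sigma> permutes V"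
  shows "(\<forall>x\<in>V. f (\<sigma> x) = f x) \<longleftrightarrow> (\<forall>x\<in>V. \<forall>y\<in>V. orbit \<sigma> x = orbit \<sigma> y \<longrightarrow> f x = f y)"
proof (intro iffI ballI impI)
  have \<sigma>: "permutation \<sigma>"
    using assms by (rule permutes_imp_permutation)
  show "f x = f y" if inv: "\<forall>x\<in>V. f (\<sigma> x) = f x" and "x \<in> V" "y \<in> V" "orbit \<sigma> x = orbit \<sigma> y" for x y
  proof -
    have "y \<in> orbit \<sigma> x"
      using that permutation_self_in_orbit[OF \<sigma>] by simp
    then show ?thesis
      by induction (use inv permutes_orbit_subset[OF assms(2) \<open>x \<in> V\<close>] \<open>x \<in> V\<close> in auto)
  qed
  show "f (\<sigma> x) = f x" if "\<forall>x\<in>V. \<forall>y\<in>V. orbit \<sigma> x = orbit \<sigma> y \<longrightarrow> f x = f y" "x \<in> V" for x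
    using that permutation_orbit_step[OF \<sigma>] permutes_in_image[OF assms(2)] by blast
qed

lemma colour_monomial_compose_orbit:
  assumes "finite V" "\<sigma> permutes V"
  shows "colour_monomial V (compose V g (orbit \<sigma>)) = (\<Prod>C\<in>orbit \<sigma> ` V. mvar (g C) ^ card C)"
proof -
  have \<sigma>: "permutation \<sigma>"
    using assms by (rule permutes_imp_permutation)
  have "(\<Prod>x | x \<in> V \<and> orbit \<sigma> x = C. mvar (g (orbit \<sigma> x))) = mvar (g C) ^ card C"
    if "C \<in> orbit \<sigma> ` V" for C
  proof -
    have "{x \<in> V. orbit \<sigma> x = C} = C"
      using that permutation_orbit_eq[OF \<sigma>] permutation_self_in_orbit[OF \<sigma>]
        permutes_orbit_subset[OF assms(2)] by blast
    moreover have "(\<Prod>x | x \<in> V \<and> orbit \<sigma> x = C. mvar (g (orbit \<sigma> x))) =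
        (\<Prod>x | x \<in> V \<and> orbit \<sigma> x = C. mvar (g C))"
      by (rule prod.cong) auto
    ultimately show ?thesis
      by (simp only: prod_constant)
  qed
  then have "(\<Prod>x\<in>V. mvar (g (orbit \<sigma> x))) = (\<Prod>C\<in>orbit \<sigma> ` V. mvar (g C) ^ card C)"
    unfolding prod.image_gen[OF assms(1), of _ "orbit \<sigma>"] by (rule prod.cong[OF refl])
  then show ?thesis
    by (simp add: colour_monomial_def compose_def)
qed

lemma power_sum_partition_perm_type:
  assumes "finite V" "\<sigma> permutes V"
  shows "power_sum_partition (perm_type V \<sigma>) =
    formal_sum (colour_monomial V) {f \<in> V \<rightarrow>\<^sub>E {0<..}. \<forall>x\<in>V. f (\<sigma> x) = f x}"
proof -
  have \<sigma>: "permutation \<sigma>"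
    using assms by (rule permutes_imp_permutation)
  have "0 < card C" if "C \<in> orbit \<sigma> ` V" for C
    using that finite_orbit[OF permutation_self_in_orbit[OF \<sigma>]]
    by (auto simp: card_gt_0_iff orbit_nonempty)
  then have summable: "formally_summable (\<lambda>i. mvar i ^ card C :: int mvps) {0<..}"
    if "C \<in> orbit \<sigma> ` V" for C
    using power_sum_summable[of "card C" "{0<..}", where 'a = int] that
    by (simp add: formally_summable_def)
  have "power_sum_partition (perm_type V \<sigma>) =
      (\<Prod>C\<in>orbit \<sigma> ` V. formal_sum (\<lambda>i. mvar i ^ card C) {0<..})"
    unfolding power_sum_partition_perm_type_eq_prod_orbits[OF \<sigma>] power_sum_def greaterThan_def ..
  also have "\<dots> = formal_sum (\<lambda>g. \<Prod>C\<in>orbit \<sigma> ` V. mvar (g C) ^ card C) (orbit \<sigma> ` V \<rightarrow>\<^sub>E {0<..})"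
    using assms(1) summable by (intro prod_formal_sum) auto
  also have "\<dots> = formal_sum (colour_monomial V)
      {f \<in> V \<rightarrow>\<^sub>E {0<..}. \<forall>x\<in>V. \<forall>y\<in>V. orbit \<sigma> x = orbit \<sigma> y \<longrightarrow> f x = f y}"
    unfolding formal_sum_reindex[OF bij_betw_compose_fibres]
    by (simp add: comp_def colour_monomial_compose_orbit[OF assms])
  finally show ?thesis
    unfolding invariant_iff_constant_on_orbits[OF assms] .
qed


subsection \<open>Step weights along cycles\<close>

lemma exists_ascent:
  fixes f :: "'a \<Rightarrow> 'b :: {ordered_cancel_comm_monoid_add, linorder}"
  assumes "finite C" "bij_betw \<sigma> C C" "x \<in> C" "f (\<sigma> x) \<noteq> f x"
  shows "\<exists>y\<in>C. f y < f (\<sigma> y)"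
proof (rule ccontr)
  assume "\<not> ?thesis"
  then have "\<forall>y\<in>C. f (\<sigma> y) \<le> f y"
    by (simp add: not_less)
  moreover from this have "\<exists>y\<in>C. f (\<sigma> y) < f y"
    using assms(3,4) by (auto simp: order.strict_iff_order)
  ultimately have "(\<Sum>y\<in>C. f (\<sigma> y)) < (\<Sum>y\<in>C. f y)"
    by (rule sum_strict_mono_ex1[OF assms(1)])
  then show False
    by (simp add: sum.reindex_bij_betw[OF assms(2)])
qed

lemma exists_descent:
  fixes f :: "'a \<Rightarrow> 'b :: {ordered_cancel_comm_monoid_add, linorder}"
  assumes "finite C" "bij_betw \<sigma> C C" "x \<in> C" "f (\<sigma> x) \<noteq> f x"
  shows "\<exists>y\<in>C. f (\<sigma> y) < f y"
proof -
  have "inv_into C \<sigma> (\<sigma> x) = x"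
    using assms(2,3) by (rule bij_betw_inv_into_left)
  then obtain y where y: "y \<in> C" "f y < f (inv_into C \<sigma> y)"
    using exists_ascent[OF assms(1) bij_betw_inv_into[OF assms(2)], of "\<sigma> x" f] assms(2-4)
    by (auto dest: bij_betwE)
  then show ?thesis
    using assms(2) by (intro bexI[of _ "inv_into C \<sigma> y"])
      (auto simp: bij_betw_inv_into_right bij_betw_apply[OF bij_betw_inv_into])
qed

lemma cycle_weight_step_weight_nonconstant:
  assumes "finite C" "bij_betw \<sigma> C C" "x \<in> C" "f (\<sigma> x) \<noteq> f x"
  shows "cycle_weight (step_weight A f) \<sigma> C = (0 :: 'b :: comm_ring_1)"
proof -
  obtain y where "y \<in> C" "f y < f (\<sigma> y)"
    using exists_ascent[OF assms] by blast
  then have ascent: "(\<Prod>x\<in>C. step_weight A f x (\<sigma> x)) = (0 :: 'b)"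
    using assms(1)
    by (intro prod_zero bexI[of _ y]) (simp_all add: step_weight_def admissible_step_def)
  obtain z where "z \<in> C" "f (\<sigma> z) < f z"
    using exists_descent[OF assms] by blast
  then have "(\<Prod>x\<in>C. 1 + step_weight A f x (\<sigma> x)) = (0 :: 'b)"
    using assms(1)
    by (intro prod_zero bexI[of _ z]) (simp_all add: step_weight_def admissible_step_def)
  then show ?thesis
    using ascent by (simp add: cycle_weight_def)
qed

lemma cycle_weight_step_weight_constant:
  assumes "finite C" "C \<noteq> {}" "\<forall>x\<in>C. f (\<sigma> x) = f x"
  shows "cycle_weight (step_weight A f) \<sigma> C =
    (if perm_arcs \<sigma> C \<subseteq> A then (-1) ^ (card C - 1) else of_bool (disjnt (perm_arcs \<sigma> C) A)
      :: 'b :: comm_ring_1)"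
proof -
  have arcs: "perm_arcs \<sigma> C \<subseteq> A \<longleftrightarrow> (\<forall>x\<in>C. (x, \<sigma> x) \<in> A)"
    "disjnt (perm_arcs \<sigma> C) A \<longleftrightarrow> (\<forall>x\<in>C. (x, \<sigma> x) \<notin> A)"
    by (auto simp: perm_arcs_def disjnt_def)
  have weight: "step_weight A f x (\<sigma> x) = (if (x, \<sigma> x) \<in> A then -1 else 0 :: 'b)" if "x \<in> C" for x
    using that assms(3) by (simp add: step_weight_def admissible_step_def)
  have "(\<Prod>x\<in>C. 1 + step_weight A f x (\<sigma> x)) = (of_bool (\<forall>x\<in>C. (x, \<sigma> x) \<notin> A) :: 'b)"
    using assms(1) by (auto simp: weight intro!: prod.neutral prod_zero)
  moreover have "(\<Prod>x\<in>C. step_weight A f x (\<sigma> x)) =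
      (if \<forall>x\<in>C. (x, \<sigma> x) \<in> A then (-1) ^ card C else 0 :: 'b)"
    using assms(1) by (auto simp: weight intro!: prod_zero)
  moreover have "card C = Suc (card C - 1)"
    using assms(1,2) by (simp add: card_gt_0_iff)
  then have "(-1 :: 'b) ^ card C = - ((-1) ^ (card C - 1))"
    by (metis power_Suc mult_minus1)
  ultimately show ?thesis
    unfolding cycle_weight_def arcs using assms(2) by auto
qed

lemma bij_betw_orbit:
  assumes "permutation \<sigma>"
  shows "bij_betw \<sigma> (orbit \<sigma> x) (orbit \<sigma> x)"
proof -
  have "finite (orbit \<sigma> x)"
    using permutation_self_in_orbit[OF assms] by (rule finite_orbit)
  moreover have "inj_on \<sigma> (orbit \<sigma> x)"
    using assms by (meson bij_is_inj inj_on_subset permutation_bijective subset_UNIV)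
  moreover have "\<sigma> ` orbit \<sigma> x \<subseteq> orbit \<sigma> x"
    by (auto intro: orbit.step)
  ultimately show ?thesis
    by (simp add: bij_betw_def endo_inj_surj)
qed

lemma cycle_weight_step_weight_orbit:
  assumes "permutation \<sigma>"
  shows "cycle_weight (step_weight A f) \<sigma> (orbit \<sigma> x) =
    of_bool ((\<forall>y\<in>orbit \<sigma> x. f (\<sigma> y) = f y) \<and>
      (perm_arcs \<sigma> (orbit \<sigma> x) \<subseteq> A \<or> disjnt (perm_arcs \<sigma> (orbit \<sigma> x)) A)) *
    (if perm_arcs \<sigma> (orbit \<sigma> x) \<subseteq> A then (-1) ^ (card (orbit \<sigma> x) - 1) else 1)"
proof -
  have fin: "finite (orbit \<sigma> x)"
    using permutation_self_in_orbit[OF assms] by (rule finite_orbit)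
  show ?thesis
  proof (cases "\<forall>y\<in>orbit \<sigma> x. f (\<sigma> y) = f y")
    case True
    then show ?thesis
      by (simp add: cycle_weight_step_weight_constant[OF fin orbit_nonempty])
  next
    case False
    then show ?thesis
      using cycle_weight_step_weight_nonconstant[OF fin bij_betw_orbit[OF assms]] by auto
  qed
qed

lemma prod_of_bool:
  assumes "finite A"
  shows "(\<Prod>x\<in>A. of_bool (P x) :: 'b :: comm_semiring_1) = of_bool (\<forall>x\<in>A. P x)"
  using assms by (induction rule: finite_induct) auto

lemma permutation_weight_step_weight:
  assumes "finite (pverts D)" "\<sigma> permutes pverts D"
  shows "permutation_weight (step_weight (parcs D) f) (pverts D) \<sigma> =
    (of_bool (\<sigma> \<in> digraph_perms D \<and> (\<forall>x\<in>pverts D. f (\<sigma> x) = f x)) * (-1) ^ phi D \<sigma>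
      :: 'b :: comm_ring_1)"
proof -
  let ?O = "orbit \<sigma> ` pverts D"
  have \<sigma>: "permutation \<sigma>"
    using assms by (rule permutes_imp_permutation)
  define good where "good C \<longleftrightarrow> (\<forall>x\<in>C. f (\<sigma> x) = f x) \<and>
    (perm_arcs \<sigma> C \<subseteq> parcs D \<or> disjnt (perm_arcs \<sigma> C) (parcs D))" for C
  have "pverts D = \<Union>?O"
    using permutation_self_in_orbit[OF \<sigma>] permutes_orbit_subset[OF assms(2)] by blast
  then have good: "(\<forall>C\<in>?O. good C) \<longleftrightarrow> \<sigma> \<in> digraph_perms D \<and> (\<forall>x\<in>pverts D. f (\<sigma> x) = f x)"
    unfolding digraph_perms_iff_orbits[OF assms] good_def by blast
  have "permutation_weight (step_weight (parcs D) f) (pverts D) \<sigma> =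
      (\<Prod>C\<in>?O. of_bool (good C)) *
      (\<Prod>C\<in>?O. if perm_arcs \<sigma> C \<subseteq> parcs D then (-1) ^ (card C - 1) else 1)"
    unfolding permutation_weight_def prod.distrib[symmetric] good_def
    by (rule prod.cong[OF refl]) (elim imageE, simp only: cycle_weight_step_weight_orbit[OF \<sigma>])
  also have "(\<Prod>C\<in>?O. of_bool (good C) :: 'b) = of_bool (\<forall>C\<in>?O. good C)"
    using assms(1) by (simp only: prod_of_bool finite_imageI)
  also have "(\<Prod>C\<in>?O. if perm_arcs \<sigma> C \<subseteq> parcs D then (-1) ^ (card C - 1) else 1 :: 'b) =
      (-1) ^ phi D \<sigma>"
    unfolding phi_eq_sum_orbits[OF assms] power_sum
    using assms(1) by (simp only: prod.inter_filter[symmetric] finite_imageI)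
  finally show ?thesis
    unfolding good .
qed

lemma sum_path_weight_step_weight:
  assumes "finite (pverts D)"
  shows "(\<Sum>w\<in>permutations_of_set (pverts D). path_weight (step_weight (parcs D) f) w) =
    (\<Sum>\<sigma>\<in>digraph_perms D. (-1) ^ phi D \<sigma> * of_bool (\<forall>x\<in>pverts D. f (\<sigma> x) = f x))"
  unfolding sum_path_weight_eq_sum_permutation_weight[OF assms]
proof (rule sum.mono_neutral_cong_right)
  show "digraph_perms D \<subseteq> {\<sigma>. \<sigma> permutes pverts D}"
    by (auto simp: digraph_perms_def)
qed (auto simp: assms finite_permutations permutation_weight_step_weight digraph_perms_def)

lemma redei_berge_eq_formal_sum:
  assumes "finite (pverts D)"
  shows "redei_berge D =
    formal_sum (\<lambda>f. (\<Sum>w\<in>permutations_of_set (pverts D). path_weight (step_weight (parcs D) f) w) *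
      colour_monomial (pverts D) f) (pverts D \<rightarrow>\<^sub>E {0<..})"
proof -
  have "redei_berge D =
      (\<Sum>w\<in>permutations_of_set (pverts D). formal_sum
        (\<lambda>f. path_weight (step_weight (parcs D) f) w * colour_monomial (pverts D) f)
        (pverts D \<rightarrow>\<^sub>E {0<..}))"
    by (simp add: redei_berge_def fundamental_qsym_Des formal_sum_filter path_weight_step_weight)
  then show ?thesis
    using assms
    by (simp add: sum_distrib_right formal_sum_sum formally_summable_mult_left
        formally_summable_colour_monomial)
qed

theorem theorem1p31:
  fixes D :: "'a pair_pre_digraph"
  assumes "pair_fin_digraph D"
  shows "redei_berge D =
    (\<Sum>\<sigma>\<in>digraph_perms D. (-1) ^ phi D \<sigma> * power_sum_partition (perm_type (pverts D) \<sigma>))"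
proof -
  let ?F = "pverts D \<rightarrow>\<^sub>E {0 :: nat<..}"
  let ?x = "colour_monomial (pverts D) :: _ \<Rightarrow> int mvps"
  have fin: "finite (pverts D)"
    using assms by (rule pair_fin_digraph.pair_finite_verts)
  have "redei_berge D = formal_sum (\<lambda>f. \<Sum>\<sigma>\<in>digraph_perms D.
      (-1) ^ phi D \<sigma> * (of_bool (\<forall>x\<in>pverts D. f (\<sigma> x) = f x) * ?x f)) ?F"
    by (simp only: redei_berge_eq_formal_sum[OF fin] sum_path_weight_step_weight[OF fin]
        sum_distrib_right mult.assoc)
  also have "\<dots> = (\<Sum>\<sigma>\<in>digraph_perms D.
      (-1) ^ phi D \<sigma> * formal_sum ?x {f \<in> ?F. \<forall>x\<in>pverts D. f (\<sigma> x) = f x})"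
    using fin
    by (simp add: formal_sum_sum mult_formal_sum formal_sum_filter formally_summable_mult_left
        formally_summable_colour_monomial)
  also have "\<dots> = (\<Sum>\<sigma>\<in>digraph_perms D.
      (-1) ^ phi D \<sigma> * power_sum_partition (perm_type (pverts D) \<sigma>))"
    using fin by (intro sum.cong refl) (simp add: digraph_perms_def power_sum_partition_perm_type)
  finally show ?thesis .
qed

end
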